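(* Let $n,m\ge1$, $N=2^n$, $M=2^m$, let $p,q,r,s\in\mathbb{Z}_N$, $c\in\mathbb{Z}_M$, and let $G$ be the group defined by the presentation $$G=\left\langle a,b,t,z \;\middle|\; \begin{array}{l} a^N=b^N=t^2=z^M=1,\ [a,b]=1,\\ a^t=b,\ b^t=a,\\ a^z=a^{1+p}b^{q},\ b^z=a^{q}b^{1+p},\\ t^z=t\,z^{2c}a^{r}b^{s}\end{array}\right\rangle .$$ Put $H=\langle a,b,t\rangle$, $K=\langle z\rangle$, $B=\langle a,b\rangle$, and assume that $G=HK$ is an exact product with $H\cong\mathrm{W}_{2^n}$, $K\cong C_{2^m}$ and $B$ normal in $G$. Then $$z^t\equiv z^{1-2c}\pmod B,$$ i.e. there exists $\beta\in B$ with $z^t=z^{1-2c}\beta$. Writing $k:=(1-2c)\bmod M$, the quotient $G/B$ is abelian and $H$ is normal in $G$ precisely when $k\equiv1\pmod M$, equivalently $2c\equiv0\pmod M$. Otherwise $G/B$ is non-abelian of order $2M$ with the cyclic subgroup $\langle zB\rangle$ of index $2$, and is one of three types -- dihedral, semidihedral, or modular maximal-cyclic -- according to the residue of $k$ modulo $M$. In all these non-split cases (i.e. whenever $2c\not\equiv0\pmod M$), $H$ is not normal in $G$.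
   Context: All groups are finite; $g^h=h^{-1}gh$, $[g,h]=g^{-1}h^{-1}gh$; $\mathbb{Z}_N=\mathbb{Z}/N\mathbb{Z}$. The wreathed $2$-group is $\mathrm{W}_{2^n}=C_{2^n}\wr C_2=\langle a,b,t\mid a^N=b^N=t^2=1,\ [a,b]=1,\ a^t=b,\ b^t=a\rangle$, of order $2N^2$, with base $\langle a\rangle\times\langle b\rangle\cong(\mathbb{Z}_N)^2$. A product $G=HK$ of subgroups is exact if $H\cap K=\{1\}$. The groups of order $2M$ named above are $\langle x,y\mid x^M=y^2=1,\ x^y=x^{j}\rangle$ with $j=M-1$ (dihedral), $j=M/2-1$ (semidihedral), $j=M/2+1$ (modular maximal-cyclic). *)

theory Defs
  imports "HOL-Algebra.Algebra" "HOL-Number_Theory.Cong"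
begin

section \<open>Groups given by generators and relations\<close>

text \<open>
  A letter \<open>(x, False)\<close> stands for the generator \<open>x\<close>, a letter \<open>(x, True)\<close> for its formal
  inverse.  Every element of the type \<open>'g\<close> is a generator.
\<close>

type_synonym 'g word = "('g \<times> bool) list"

definition wgen :: "'g \<Rightarrow> 'g word" where
  "wgen x = [(x, False)]"

definition winv :: "'g word \<Rightarrow> 'g word" where
  "winv w = rev (map (\<lambda>(x, e). (x, \<not> e)) w)"

definition wpow :: "'g word \<Rightarrow> int \<Rightarrow> 'g word" where
  "wpow w i = (if 0 \<le> i then concat (replicate (nat i) w)
               else concat (replicate (nat (- i)) (winv w)))"

text \<open>Conventions: \<open>g\<^sup>h = h\<^sup>-\<^sup>1 g h\<close> and \<open>[g,h] = g\<^sup>-\<^sup>1 h\<^sup>-\<^sup>1 g h\<close>.\<close>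

definition wconj :: "'g word \<Rightarrow> 'g word \<Rightarrow> 'g word" where
  "wconj g h = winv h @ g @ h"

definition wcomm :: "'g word \<Rightarrow> 'g word \<Rightarrow> 'g word" where
  "wcomm g h = winv g @ winv h @ g @ h"

text \<open>
  A pair \<open>(u, v)\<close> in \<open>R\<close> is the defining relation \<open>u = v\<close>.  The presented group consists of the
  words modulo the smallest congruence of the free monoid that contains \<open>R\<close> and all free
  cancellations.
\<close>

inductive pres_eq :: "('g word \<times> 'g word) set \<Rightarrow> 'g word \<Rightarrow> 'g word \<Rightarrow> bool"
  for R :: "('g word \<times> 'g word) set" where
  pres_eq_refl: "pres_eq R u u"
| pres_eq_sym: "pres_eq R u v \<Longrightarrow> pres_eq R v u"
| pres_eq_trans: "pres_eq R u v \<Longrightarrow> pres_eq R v w \<Longrightarrow> pres_eq R u w"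
| pres_eq_append: "pres_eq R u u' \<Longrightarrow> pres_eq R v v' \<Longrightarrow> pres_eq R (u @ v) (u' @ v')"
| pres_eq_cancel: "pres_eq R [(x, e), (x, \<not> e)] []"
| pres_eq_rel: "(u, v) \<in> R \<Longrightarrow> pres_eq R u v"

definition pres_class :: "('g word \<times> 'g word) set \<Rightarrow> 'g word \<Rightarrow> 'g word set" where
  "pres_class R w = {v. pres_eq R w v}"

definition presented_group :: "('g word \<times> 'g word) set \<Rightarrow> 'g word set monoid" where
  "presented_group R =
     \<lparr>carrier = range (pres_class R),
      monoid.mult = (\<lambda>A B. \<Union>u\<in>A. \<Union>v\<in>B. pres_class R (u @ v)),
      one = pres_class R []\<rparr>"

definition pres_gen :: "('g word \<times> 'g word) set \<Rightarrow> 'g \<Rightarrow> 'g word set" where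
  "pres_gen R x = pres_class R (wgen x)"

lemma pres_class_eq_iff: "pres_class R u = pres_class R v \<longleftrightarrow> pres_eq R u v"
proof
  assume "pres_class R u = pres_class R v"
  then show "pres_eq R u v"
    using pres_eq_refl[of R v] by (simp add: pres_class_def set_eq_iff)
next
  assume uv: "pres_eq R u v"
  have "pres_eq R u w \<longleftrightarrow> pres_eq R v w" for w
    using pres_eq_trans[OF uv] pres_eq_trans[OF pres_eq_sym[OF uv]] by blast
  then show "pres_class R u = pres_class R v"
    by (simp add: pres_class_def)
qed

lemma carrier_presented_group: "carrier (presented_group R) = range (pres_class R)"
  and one_presented_group: "\<one>\<^bsub>presented_group R\<^esub> = pres_class R []"
  by (simp_all add: presented_group_def)

lemma mult_presented_group:
  "pres_class R u \<otimes>\<^bsub>presented_group R\<^esub> pres_class R v = pres_class R (u @ v)"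
proof -
  have "pres_class R (u' @ v') = pres_class R (u @ v)"
    if "u' \<in> pres_class R u" "v' \<in> pres_class R v" for u' v'
    using that unfolding pres_class_eq_iff
    by (simp add: pres_class_def pres_eq_append pres_eq_sym)
  moreover have "u \<in> pres_class R u" "v \<in> pres_class R v"
    by (simp_all add: pres_class_def pres_eq_refl)
  ultimately have "(\<Union>u'\<in>pres_class R u. \<Union>v'\<in>pres_class R v. pres_class R (u' @ v')) =
      pres_class R (u @ v)"
    by blast
  then show ?thesis
    by (simp add: presented_group_def)
qed

lemma pres_eq_winv: "pres_eq R (winv w @ w) []"
proof (induction w)
  case Nil
  show ?case by (simp add: winv_def pres_eq_refl)
next
  case (Cons l w)
  obtain x e where l: "l = (x, e)" by (cases l)
  have "pres_eq R ([(x, \<not> e), (x, e)] @ w) ([] @ w)"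
    by (rule pres_eq_append[OF _ pres_eq_refl]) (use pres_eq_cancel[of R x "\<not> e"] in simp)
  then have "pres_eq R (winv w @ [(x, \<not> e), (x, e)] @ w) (winv w @ w)"
    using pres_eq_append[OF pres_eq_refl, of R _ _ "winv w"] by simp
  from pres_eq_trans[OF this Cons.IH] show ?case
    by (simp add: winv_def l)
qed

lemma group_presented_group: "group (presented_group R)"
proof (rule groupI)
  fix A assume "A \<in> carrier (presented_group R)"
  then obtain u where u: "A = pres_class R u"
    by (auto simp: carrier_presented_group)
  show "\<exists>B\<in>carrier (presented_group R). B \<otimes>\<^bsub>presented_group R\<^esub> A = \<one>\<^bsub>presented_group R\<^esub>"
    unfolding u carrier_presented_group one_presented_group
    by (rule bexI[of _ "pres_class R (winv u)"])
       (auto simp: mult_presented_group pres_class_eq_iff pres_eq_winv)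
qed (auto simp: carrier_presented_group one_presented_group mult_presented_group)


section \<open>Wreathed 2-groups, their extensions, and 2-groups with a cyclic maximal subgroup\<close>

datatype wreathed_gen = Wa | Wb | Wt

text \<open>The wreathed 2-group \<open>C\<^sub>N \<wr> C\<^sub>2\<close> with \<open>N = 2\<^sup>n\<close>.\<close>

definition wreathed_rels :: "nat \<Rightarrow> (wreathed_gen word \<times> wreathed_gen word) set" where
  "wreathed_rels n =
     (let N = 2 ^ n; a = wgen Wa; b = wgen Wb; t = wgen Wt
      in {(wpow a N, []), (wpow b N, []), (wpow t 2, []), (wcomm a b, []),
          (wconj a t, b), (wconj b t, a)})"

definition wreathed_group :: "nat \<Rightarrow> wreathed_gen word set monoid" where
  "wreathed_group n = presented_group (wreathed_rels n)"

datatype ext_gen = Ga | Gb | Gt | Gz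

text \<open>
  The parameters \<open>p, q, r, s\<close> (residues modulo \<open>2\<^sup>n\<close>) and \<open>c\<close> (a residue modulo \<open>2\<^sup>m\<close>) enter
  through integer representatives; the choice does not matter in the presented group, because
  \<open>a\<^sup>N = b\<^sup>N = z\<^sup>M = 1\<close> are among the relations.
\<close>

definition ext_rels ::
  "nat \<Rightarrow> nat \<Rightarrow> int \<Rightarrow> int \<Rightarrow> int \<Rightarrow> int \<Rightarrow> int \<Rightarrow> (ext_gen word \<times> ext_gen word) set" where
  "ext_rels n m p q r s c =
     (let N = 2 ^ n; M = 2 ^ m; a = wgen Ga; b = wgen Gb; t = wgen Gt; z = wgen Gz
      in {(wpow a N, []), (wpow b N, []), (wpow t 2, []), (wpow z M, []), (wcomm a b, []),
          (wconj a t, b), (wconj b t, a),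
          (wconj a z, wpow a (1 + p) @ wpow b q),
          (wconj b z, wpow a q @ wpow b (1 + p)),
          (wconj t z, t @ wpow z (2 * c) @ wpow a r @ wpow b s)})"

datatype two_gen = Dx | Dy

definition max_cyclic_rels :: "nat \<Rightarrow> int \<Rightarrow> (two_gen word \<times> two_gen word) set" where
  "max_cyclic_rels M j =
     (let x = wgen Dx; y = wgen Dy
      in {(wpow x (int M), []), (wpow y 2, []), (wconj x y, wpow x j)})"

text \<open>The following are indexed by the order \<open>M\<close> of the generator \<open>x\<close>; the groups have order \<open>2M\<close>.\<close>

definition dihedral_group :: "nat \<Rightarrow> two_gen word set monoid" where
  "dihedral_group M = presented_group (max_cyclic_rels M (int M - 1))"

definition semidihedral_group :: "nat \<Rightarrow> two_gen word set monoid" where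
  "semidihedral_group M = presented_group (max_cyclic_rels M (int M div 2 - 1))"

definition modular_max_cyclic_group :: "nat \<Rightarrow> two_gen word set monoid" where
  "modular_max_cyclic_group M = presented_group (max_cyclic_rels M (int M div 2 + 1))"

definition exact_product :: "('a, 'b) monoid_scheme \<Rightarrow> 'a set \<Rightarrow> 'a set \<Rightarrow> bool" where
  "exact_product G H K \<longleftrightarrow>
     subgroup H G \<and> subgroup K G \<and> carrier G = H <#>\<^bsub>G\<^esub> K \<and> H \<inter> K = {\<one>\<^bsub>G\<^esub>}"

end

theory Submission
  imports Defs
begin

text \<open>
  Everything happens in the quotient \<open>Q = G/B\<close>.  There \<open>a\<close> and \<open>b\<close> vanish, and the relation for
  \<open>t\<^sup>z\<close> becomes \<open>t\<^sup>z = t z\<^sup>2\<^sup>c\<close>; solved for \<open>z\<^sup>t\<close>, with \<open>t\<^sup>2 = 1\<close>, it reads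
  \<open>z\<^sup>t = z\<^sup>k\<close> with \<open>k = 1 - 2c\<close> (\<open>conj_eq_mult_pow_swap\<close>).

  The exact factorization \<open>G = HK\<close> shows that nothing more collapses in \<open>Q\<close>.  As \<open>B \<subseteq> H\<close> and
  \<open>H \<inter> K = 1\<close>, the image of \<open>z\<close> still has order \<open>M\<close>.  The image of \<open>t\<close> is not a power of it:
  otherwise \<open>t \<in> B\<close>, so \<open>H = B\<close> would be abelian, whereas the wreathed group is not
  (\<open>wreathed_group_not_comm\<close>).  Since \<open>H = B \<union> tB\<close>, the group \<open>Q\<close> consists of the \<open>2M\<close> elements
  \<open>z\<^sup>i\<close> and \<open>t z\<^sup>i\<close>.  The locale \<open>cyclic_by_involution\<close> describes precisely such groups: they
  are abelian if and only if \<open>k \<equiv> 1\<close>, and they are determined by \<open>M\<close> and the residue of \<open>k\<close>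
  modulo \<open>M\<close>, namely as the presented group with \<open>x\<^sup>M = y\<^sup>2 = 1\<close>, \<open>x\<^sup>y = x\<^sup>k\<close>
  (\<open>iso_presented_group\<close>).

  Conjugating twice by the involution gives \<open>k\<^sup>2 \<equiv> 1\<close> modulo \<open>M = 2\<^sup>m\<close>, and the only square roots
  of 1 modulo a power of two are \<open>\<plusminus>1\<close> and \<open>M/2 \<plusminus> 1\<close> (\<open>sqrt_one_mod_power_of_two\<close>).  Apart from
  \<open>k \<equiv> 1\<close> these are the dihedral, semidihedral and modular cases.

  For the normality of \<open>H\<close>: if \<open>Q\<close> is abelian, then every subgroup containing \<open>B\<close> is normal
  (\<open>normal_above_if_factgroup_comm\<close>).  Conversely, if \<open>H\<close> is normal, then \<open>t\<^sup>z \<in> H\<close>, so the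
  relation for \<open>t\<^sup>z\<close> puts \<open>z\<^sup>2\<^sup>c\<close> into \<open>H \<inter> K = 1\<close>, and \<open>M\<close> divides \<open>2c\<close>.
\<close>

section \<open>Evaluating words in a group\<close>

definition (in monoid) word_eval :: "('g \<Rightarrow> 'a) \<Rightarrow> 'g word \<Rightarrow> 'a" where
  "word_eval f w = foldr (\<lambda>(x, e) g. (if e then inv (f x) else f x) \<otimes> g) w \<one>"

context group
begin

context
  fixes f :: "'g \<Rightarrow> 'a"
  assumes f: "\<And>x. f x \<in> carrier G"
begin

lemma word_eval_closed [simp]: "word_eval f w \<in> carrier G"
  by (induction w) (auto simp: word_eval_def f)

lemma word_eval_append [simp]: "word_eval f (u @ v) = word_eval f u \<otimes> word_eval f v"
proof (induction u)
  case Nil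
  show ?case using word_eval_closed[of v] by (simp add: word_eval_def)
next
  case (Cons l u)
  have "word_eval f (l # w) = word_eval f [l] \<otimes> word_eval f w" for w
    using word_eval_closed[of w] by (cases l) (auto simp: word_eval_def f)
  from this[of "u @ v"] this[of u] Cons show ?case
    by (simp add: m_assoc)
qed

lemma word_eval_Nil [simp]: "word_eval f [] = \<one>"
  by (simp add: word_eval_def)

lemma word_eval_wgen [simp]: "word_eval f (wgen x) = f x"
  by (simp add: word_eval_def wgen_def f)

lemma word_eval_pres_eq:
  assumes "pres_eq R u v" and rel: "\<And>u v. (u, v) \<in> R \<Longrightarrow> word_eval f u = word_eval f v"
  shows "word_eval f u = word_eval f v"
  using assms(1)
proof induction
  case (pres_eq_cancel x e)
  show ?case by (cases e) (simp_all add: word_eval_def f)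
qed (simp_all add: rel)

lemma word_eval_winv [simp]: "word_eval f (winv w) = inv (word_eval f w)"
proof -
  \<comment> \<open>Already the free group, which has no relations to check, identifies the two words.\<close>
  have "word_eval f (winv w @ w) = word_eval f []"
    by (rule word_eval_pres_eq[OF pres_eq_winv[of "{}"]]) simp
  then show ?thesis
    using inv_equality[of "word_eval f (winv w)" "word_eval f w"] by simp
qed

lemma word_eval_wpow [simp]: "word_eval f (wpow w i) = word_eval f w [^] i"
proof -
  have pow: "word_eval f (concat (replicate k v)) = word_eval f v [^] k" for k :: nat and v
  proof (induction k)
    case (Suc k)
    then show ?case using nat_pow_Suc2[of "word_eval f v" k] by simp
  qed simp
  show ?thesis
    by (simp add: wpow_def pow int_pow_inv int_pow_neg)
qed

lemma word_eval_wconj [simp]: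
  "word_eval f (wconj u v) = inv (word_eval f v) \<otimes> word_eval f u \<otimes> word_eval f v"
  by (simp add: wconj_def m_assoc)

lemma word_eval_wcomm [simp]:
  "word_eval f (wcomm u v) =
     inv (word_eval f u) \<otimes> inv (word_eval f v) \<otimes> word_eval f u \<otimes> word_eval f v"
  by (simp add: wcomm_def m_assoc)

text \<open>
  Von Dyck's theorem: once the defining relations hold in a group, evaluation is constant on
  the classes of words, so it descends to the presented group.
\<close>

lemma presented_group_hom:
  assumes rel: "\<And>u v. (u, v) \<in> R \<Longrightarrow> word_eval f u = word_eval f v"
  obtains h where "h \<in> hom (presented_group R) G" "\<And>w. h (pres_class R w) = word_eval f w"
proof
  define h where "h A = (THE g. word_eval f ` A = {g})" for A
  show h: "h (pres_class R w) = word_eval f w" for w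
  proof -
    have "word_eval f v = word_eval f w" if "v \<in> pres_class R w" for v
      using word_eval_pres_eq[of R w v] that rel by (simp add: pres_class_def)
    moreover have "w \<in> pres_class R w"
      by (simp add: pres_class_def pres_eq_refl)
    ultimately have "word_eval f ` pres_class R w = {word_eval f w}"
      by blast
    then show ?thesis by (simp add: h_def)
  qed
  show "h \<in> hom (presented_group R) G"
    by (rule homI) (auto simp: carrier_presented_group mult_presented_group h)
qed

end

end

lemma pres_gen_closed [simp]: "pres_gen R x \<in> carrier (presented_group R)"
  by (simp add: pres_gen_def carrier_presented_group)

text \<open>
  Evaluating a word at the generators of a presented group returns its own class.  This turns
  a defining relation, which is a pair of words, into an equation between group elements.
\<close>

lemma word_eval_pres_gen:
  "monoid.word_eval (presented_group R) (pres_gen R) w = pres_class R w"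
proof -
  interpret group "presented_group R" by (rule group_presented_group)
  show ?thesis
  proof (induction w)
    case Nil
    show ?case by (simp add: one_presented_group)
  next
    case (Cons l w)
    obtain x e where l: "l = (x, e)" by (cases l)
    have "word_eval (pres_gen R) [l] = pres_class R [l]"
    proof (cases e)
      case True
      have "[l] = winv (wgen x)"
        by (simp add: l True winv_def wgen_def)
      moreover have "inv\<^bsub>presented_group R\<^esub> (pres_class R (wgen x)) = pres_class R (winv (wgen x))"
        by (rule inv_equality)
          (auto simp: mult_presented_group one_presented_group carrier_presented_group
            pres_class_eq_iff pres_eq_winv)
      ultimately show ?thesis
        by (simp add: pres_gen_def carrier_presented_group)
    next
      case False
      then have "[l] = wgen x" by (simp add: l wgen_def)
      then show ?thesis by (simp add: pres_gen_def carrier_presented_group)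
    qed
    moreover have "word_eval (pres_gen R) (l # w) =
        word_eval (pres_gen R) [l] \<otimes>\<^bsub>presented_group R\<^esub> word_eval (pres_gen R) w"
      using word_eval_append[of "pres_gen R" "[l]" w] by simp
    ultimately show ?case
      by (simp add: Cons mult_presented_group)
  qed
qed

lemma presented_group_relation:
  assumes "(u, v) \<in> R"
  shows "monoid.word_eval (presented_group R) (pres_gen R) u =
         monoid.word_eval (presented_group R) (pres_gen R) v"
  using assms by (simp add: word_eval_pres_gen pres_class_eq_iff pres_eq_rel)


section \<open>The wreathed group is not abelian\<close>

text \<open>
  For even \<open>N\<close> the group \<open>C\<^sub>N \<wr> C\<^sub>2\<close> has \<open>C\<^sub>2 \<wr> C\<^sub>2\<close>, the dihedral group of order 8, as a
  quotient.  It acts on pairs of bits: \<open>a\<close> and \<open>b\<close> flip one bit each, \<open>t\<close> exchanges the two.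
  In this action \<open>a\<close> and \<open>t\<close> do not commute.  All three generators act as involutions, so the
  orders required by the relations and the inverses in the conjugates are immediate.
\<close>

lemma wreathed_group_not_comm:
  assumes "n \<ge> 1"
  shows "\<not> comm_group (wreathed_group n)"
proof
  define S where "S = BijGroup (UNIV :: (bool \<times> bool) set)"
  interpret S: group S unfolding S_def by (rule group_BijGroup)
  define f :: "wreathed_gen \<Rightarrow> bool \<times> bool \<Rightarrow> bool \<times> bool" where
    "f x = (case x of Wa \<Rightarrow> (\<lambda>(i, j). (\<not> i, j)) | Wb \<Rightarrow> (\<lambda>(i, j). (i, \<not> j))
                    | Wt \<Rightarrow> (\<lambda>(i, j). (j, i)))" for x
  have invol: "f x (f x u) = u" for x u
    by (auto simp: f_def split: wreathed_gen.splits prod.splits)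
  then have bij: "bij (f x)" for x
    by (metis bijI')
  have f: "f x \<in> carrier S" for x
    using bij by (simp add: S_def BijGroup_def Bij_def)
  have mult: "g \<otimes>\<^bsub>S\<^esub> h = g \<circ> h" if "g \<in> carrier S" "h \<in> carrier S" for g h
    using that by (auto simp: S_def BijGroup_def compose_def)
  then have comp: "g \<circ> h \<in> carrier S" if "g \<in> carrier S" "h \<in> carrier S" for g h
    using that S.m_closed by metis
  have one: "\<one>\<^bsub>S\<^esub> = id"
    by (auto simp: S_def BijGroup_def)
  have sq: "f x \<otimes>\<^bsub>S\<^esub> f x = \<one>\<^bsub>S\<^esub>" for x
    by (simp add: mult f one fun_eq_iff invol)
  have inv: "inv\<^bsub>S\<^esub> f x = f x" for x
    by (rule S.inv_equality) (simp_all add: sq f)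
  have pow2: "f x [^]\<^bsub>S\<^esub> (2::int) = \<one>\<^bsub>S\<^esub>" for x
    using S.int_pow_mult[of "f x" 1 1] f sq by simp
  have "(2::int) ^ n = 2 * 2 ^ (n - 1)"
    using assms by (simp flip: power_Suc)
  then have pow: "f x [^]\<^bsub>S\<^esub> ((2::int) ^ n) = \<one>\<^bsub>S\<^esub>" for x
    using S.int_pow_pow[of "f x" 2 "2 ^ (n - 1)"] f pow2 by simp
  have "S.word_eval f u = S.word_eval f v" if "(u, v) \<in> wreathed_rels n" for u v
    using that
    by (auto simp: wreathed_rels_def Let_def f pow pow2 inv)
      (simp_all add: mult f comp one, auto simp: f_def)
  from S.presented_group_hom[OF f this]
  obtain h where h: "h \<in> hom (wreathed_group n) S"
    "\<And>w. h (pres_class (wreathed_rels n) w) = S.word_eval f w"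
    unfolding wreathed_group_def by blast
  assume "comm_group (wreathed_group n)"
  then interpret W: comm_group "wreathed_group n" .
  let ?g = "pres_gen (wreathed_rels n)"
  have g: "?g x \<in> carrier (wreathed_group n)" "h (?g x) = f x" for x
    by (simp_all add: wreathed_group_def pres_gen_def h(2) f carrier_presented_group)
  have "f Wa \<otimes>\<^bsub>S\<^esub> f Wt = f Wt \<otimes>\<^bsub>S\<^esub> f Wa"
    using hom_mult[OF h(1) g(1) g(1)] W.m_comm[OF g(1) g(1)] by (metis g(2))
  then have "f Wa (f Wt (True, True)) = f Wt (f Wa (True, True))"
    by (simp add: mult f fun_eq_iff)
  then show False by (simp add: f_def)
qed


section \<open>Extending a cyclic group by an involution\<close>

lemma (in group) conj_int_pow:
  assumes "x \<in> carrier G" "y \<in> carrier G"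
  shows "inv y \<otimes> x [^] (i::int) \<otimes> y = (inv y \<otimes> x \<otimes> y) [^] i"
proof -
  have "(\<lambda>g. inv y \<otimes> g \<otimes> y) \<in> hom G G"
  proof (rule homI)
    fix g h assume "g \<in> carrier G" "h \<in> carrier G"
    moreover from this have "y \<otimes> (inv y \<otimes> (h \<otimes> y)) = h \<otimes> y"
      using assms by (simp add: m_assoc[symmetric])
    ultimately show "inv y \<otimes> (g \<otimes> h) \<otimes> y = inv y \<otimes> g \<otimes> y \<otimes> (inv y \<otimes> h \<otimes> y)"
      using assms by (simp add: m_assoc)
  qed (use assms in simp)
  from hom_int_pow[OF this assms(1) is_group is_group] show ?thesis .
qed

text \<open>
  This is where the exponent \<open>1 - 2c\<close> originates: a relation for \<open>y\<^sup>x\<close>, of the kind imposed on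
  \<open>t\<^sup>z\<close>, is rewritten as one for \<open>x\<^sup>y\<close>.  The first relation says \<open>y x = x y x\<^sup>i\<close>; the factor
  \<open>x\<^sup>i\<close> is moved to the other side.
\<close>

lemma (in group) conj_eq_mult_pow_swap:
  assumes "x \<in> carrier G" "y \<in> carrier G" and eq: "inv x \<otimes> y \<otimes> x = y \<otimes> x [^] (i::int)"
  shows "inv y \<otimes> x \<otimes> y = x [^] (1 - i)"
proof -
  have "x \<otimes> (y \<otimes> x [^] i) = x \<otimes> (inv x \<otimes> y \<otimes> x)"
    by (simp only: eq)
  also have "\<dots> = y \<otimes> x"
    using assms(1,2) by (simp add: m_assoc[symmetric])
  finally have "x \<otimes> (y \<otimes> x [^] i) \<otimes> x [^] (- i) = y \<otimes> x \<otimes> x [^] (- i)"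
    by simp
  moreover have "x \<otimes> (y \<otimes> x [^] i) \<otimes> x [^] (- i) = x \<otimes> y"
    using assms(1,2) by (simp add: m_assoc int_pow_neg)
  moreover have "y \<otimes> x \<otimes> x [^] (- i) = y \<otimes> x [^] (1 - i)"
    using assms(1,2) int_pow_mult[of x 1 "- i"] by (simp add: m_assoc)
  ultimately have "x \<otimes> y = y \<otimes> x [^] (1 - i)"
    by simp
  then show ?thesis
    using assms(1,2) by (simp add: m_assoc inv_solve_left')
qed

text \<open>
  Only the relations are assumed here, because the locale has to cover a presented group with
  these relations before anything about the order of its elements is known.
\<close>

locale involution_action = group +
  fixes x y :: 'a and j :: int
  assumes x [simp]: "x \<in> carrier G" and y [simp]: "y \<in> carrier G"
    and y_sq: "y \<otimes> y = \<one>"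
    and x_conj: "inv y \<otimes> x \<otimes> y = x [^] j"
begin

lemma inv_y: "inv y = y"
  by (rule inv_equality) (simp_all add: y_sq)

lemma pow_x_y: "x [^] (i::int) \<otimes> y = y \<otimes> x [^] (j * i)"
proof -
  have "y \<otimes> (y \<otimes> (x [^] i \<otimes> y)) = x [^] i \<otimes> y"
    by (simp add: m_assoc[symmetric] y_sq)
  moreover have "y \<otimes> x [^] i \<otimes> y = x [^] (j * i)"
    using conj_int_pow[of x y i] x_conj int_pow_pow[of x j i] by (simp add: inv_y)
  ultimately show ?thesis
    by (simp add: m_assoc)
qed

text \<open>
  Left multiplication by the generators preserves the set of elements \<open>x\<^sup>i\<close> and \<open>y x\<^sup>i\<close>;
  by induction on words, these are all the elements of a group generated by \<open>x\<close> and \<open>y\<close>.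
\<close>

lemma normal_forms_left_mult:
  assumes g: "\<exists>i::int. g = x [^] i \<or> g = y \<otimes> x [^] i"
  shows "\<exists>i::int. x [^] (l::int) \<otimes> g = x [^] i \<or> x [^] l \<otimes> g = y \<otimes> x [^] i" (is ?x)
    and "\<exists>i::int. y \<otimes> g = x [^] i \<or> y \<otimes> g = y \<otimes> x [^] i" (is ?y)
proof -
  obtain i :: int where "g = x [^] i \<or> g = y \<otimes> x [^] i"
    using g by blast
  moreover have "x [^] l \<otimes> (y \<otimes> x [^] i) = y \<otimes> x [^] (j * l + i)"
    by (simp add: m_assoc[symmetric] pow_x_y) (simp add: m_assoc int_pow_mult)
  moreover have "x [^] l \<otimes> x [^] i = x [^] (l + i)"
    by (simp add: int_pow_mult)
  moreover have "y \<otimes> (y \<otimes> x [^] i) = x [^] i"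
    by (simp add: m_assoc[symmetric] y_sq)
  ultimately show ?x ?y
    by metis+
qed

end

text \<open>
  The cyclic group \<open>\<langle>x\<rangle>\<close> of order \<open>M\<close> has index 2, and \<open>y\<close> represents the other coset.
\<close>

locale cyclic_by_involution = involution_action +
  fixes M :: nat
  assumes M_pos: "M > 0"
    and pow_eq_one: "\<And>i::int. x [^] i = \<one> \<longleftrightarrow> int M dvd i"
    and y_notin: "\<And>i::int. y \<noteq> x [^] i"
    and normal_form: "\<And>g. g \<in> carrier G \<Longrightarrow> \<exists>i::int. g = x [^] i \<or> g = y \<otimes> x [^] i"
begin

lemma pow_eq: "x [^] (i::int) = x [^] (l::int) \<longleftrightarrow> [i = l] (mod int M)"
proof -
  have "x [^] i = x [^] l \<longleftrightarrow> x [^] (i - l) = \<one>"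
    using int_pow_diff[of x i l] by (simp add: inv_solve_right')
  then show ?thesis
    by (simp add: pow_eq_one cong_iff_dvd_diff)
qed

text \<open>
  Conjugating \<open>x\<close> twice by \<open>y\<close> raises it to the power \<open>j\<^sup>2\<close>, but \<open>y\<^sup>2 = 1\<close>.
\<close>

lemma exponent_sq: "[j * j = 1] (mod int M)"
proof -
  have "x [^] (1::int) \<otimes> y \<otimes> y = y \<otimes> (x [^] j \<otimes> y)"
    using pow_x_y[of 1] by (simp add: m_assoc)
  also have "\<dots> = x [^] (j * j)"
    by (simp add: pow_x_y m_assoc[symmetric] y_sq)
  finally have "x [^] (j * j) = x [^] (1::int)"
    by (simp add: m_assoc y_sq)
  then show ?thesis
    by (simp only: pow_eq)
qed

lemma comm_group_iff: "comm_group G \<longleftrightarrow> [j = 1] (mod int M)"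
proof
  assume "comm_group G"
  then interpret comm_group G .
  have "y \<otimes> x [^] j = y \<otimes> x [^] (1::int)"
    using pow_x_y[of 1] m_comm[of x y] by simp
  then show "[j = 1] (mod int M)"
    by (simp add: pow_eq del: int_pow_1)
next
  assume j: "[j = 1] (mod int M)"
  have y_x: "x [^] i \<otimes> y = y \<otimes> x [^] i" for i :: int
    using pow_x_y[of i] pow_eq[of "j * i" i] cong_scalar_right[OF j, of i] by simp
  have x_g: "x [^] i \<otimes> g = g \<otimes> x [^] i" if "g \<in> carrier G" for i :: int and g
  proof -
    obtain l :: int where "g = x [^] l \<or> g = y \<otimes> x [^] l"
      using normal_form \<open>g \<in> carrier G\<close> by blast
    moreover have "x [^] i \<otimes> x [^] l = x [^] l \<otimes> x [^] i"
      by (simp add: int_pow_mult[symmetric] add.commute)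
    ultimately show ?thesis
      using y_x[of i] by (metis int_pow_closed m_assoc x y)
  qed
  have y_g: "y \<otimes> g = g \<otimes> y" if "g \<in> carrier G" for g
    using normal_form[OF that] y_x by (metis int_pow_closed m_assoc x y)
  show "comm_group G"
  proof (rule group_comm_groupI)
    fix g h assume gh: "g \<in> carrier G" "h \<in> carrier G"
    then show "g \<otimes> h = h \<otimes> g"
      using normal_form[of g] x_g[OF gh(2)] y_g[OF gh(2)]
      by (metis int_pow_closed m_assoc x y)
  qed
qed

lemma card_powers: "card (generate G {x}) = M"
proof -
  have "ord x = M"
    using int_pow_eq_id[OF x, of "int M"] int_pow_eq_id[OF x, of "int (ord x)"] pow_eq_one
    by (auto intro: dvd_antisym)
  then show ?thesis
    using generate_pow_card[OF x] by simp
qed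

lemma order_eq: "order G = 2 * M"
proof -
  let ?Z = "generate G {x}"
  have Z: "?Z = range (\<lambda>i::int. x [^] i)"
    by (auto simp: generate_pow)
  have fin: "finite ?Z"
    using card_powers M_pos card_gt_0_iff by metis
  have "carrier G = ?Z \<union> (\<lambda>g. y \<otimes> g) ` ?Z"
  proof (intro equalityI subsetI)
    fix g assume "g \<in> carrier G"
    then show "g \<in> ?Z \<union> (\<lambda>g. y \<otimes> g) ` ?Z"
      using normal_form[of g] by (auto simp: Z)
  qed (auto simp: Z)
  moreover have "?Z \<inter> (\<lambda>g. y \<otimes> g) ` ?Z = {}"
  proof -
    have "x [^] i \<noteq> y \<otimes> x [^] l" for i l :: int
    proof
      assume "x [^] i = y \<otimes> x [^] l"
      then have "y = x [^] (i - l)"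
        by (simp add: int_pow_diff inv_solve_right)
      then show False using y_notin by blast
    qed
    then show ?thesis by (auto simp: Z)
  qed
  moreover have "card ((\<lambda>g. y \<otimes> g) ` ?Z) = card ?Z"
    by (rule card_image) (auto intro!: inj_onI simp: Z)
  ultimately show ?thesis
    using card_Un_disjoint[OF fin finite_imageI[OF fin]] card_powers
    by (simp add: order_def)
qed

lemma subgroup_powers: "subgroup (generate G {x}) G"
  by (rule generate_is_subgroup) simp

lemma card_rcosets_powers: "card (rcosets (generate G {x})) = 2"
  using lagrange[OF subgroup_powers] M_pos by (simp add: card_powers order_eq)

lemma cyclic_powers: "cyclic_group (G\<lparr>carrier := generate G {x}\<rparr>)"
proof -
  interpret Z: group "G\<lparr>carrier := generate G {x}\<rparr>"
    using subgroup_powers by (rule subgroup_imp_group)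
  have "x \<in> generate G {x}"
    by (simp add: generate.incl)
  moreover from this have "x [^]\<^bsub>G\<lparr>carrier := generate G {x}\<rparr>\<^esub> i = x [^] i" for i :: int
    using int_pow_consistent[OF subgroup_powers] by simp
  then have "carrier (G\<lparr>carrier := generate G {x}\<rparr>) =
      range (\<lambda>i::int. x [^]\<^bsub>G\<lparr>carrier := generate G {x}\<rparr>\<^esub> i)"
    by (simp only:) (auto simp: generate_pow)
  ultimately show ?thesis
    unfolding Z.cyclic_group by (intro bexI[of _ x]) simp_all
qed

text \<open>
  The presentation determines the group.  Von Dyck's theorem gives a surjection from the
  presented group.  Every element of the latter has the form \<open>x\<^sup>i\<close> or \<open>y x\<^sup>i\<close>; the second kind is
  never mapped to the identity since \<open>y \<notin> \<langle>x\<rangle>\<close>, and the first kind only if \<open>M\<close> divides \<open>i\<close>,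
  in which case the relation \<open>x\<^sup>M = 1\<close> makes it trivial.
\<close>

lemma iso_presented_group:
  assumes "[j = l] (mod int M)"
  shows "G \<cong> presented_group (max_cyclic_rels M l)"
proof -
  let ?R = "max_cyclic_rels M l" and ?f = "case_two_gen x y"
  let ?P = "presented_group ?R" and ?g = "pres_gen (max_cyclic_rels M l)"
  have f: "?f d \<in> carrier G" for d
    by (cases d) simp_all
  have y2: "y [^] (2::int) = \<one>"
    using int_pow_mult[of y 1 1] by (simp add: y_sq)
  have "x [^] j = x [^] l"
    using assms by (simp add: pow_eq)
  then have "word_eval ?f u = word_eval ?f v" if "(u, v) \<in> ?R" for u v
    using that by (auto simp: max_cyclic_rels_def Let_def f x_conj y2 pow_eq_one)
  from presented_group_hom[OF f this]
  obtain h where h: "h \<in> hom ?P G" "\<And>w. h (pres_class ?R w) = word_eval ?f w"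
    by blast
  interpret P: group ?P by (rule group_presented_group)
  interpret h: group_hom ?P G h
    using h(1) by unfold_locales
  have g: "?g Dx \<in> carrier ?P" "?g Dy \<in> carrier ?P" by simp_all
  have hg: "h (?g Dx) = x" "h (?g Dy) = y"
    by (simp_all add: pres_gen_def h(2) f)
  have mem: "(wpow (wgen Dx) (int M), []) \<in> ?R" "(wpow (wgen Dy) 2, []) \<in> ?R"
    "(wconj (wgen Dx) (wgen Dy), wpow (wgen Dx) l) \<in> ?R"
    by (simp_all add: max_cyclic_rels_def Let_def)
  have rels: "?g Dx [^]\<^bsub>?P\<^esub> (int M) = \<one>\<^bsub>?P\<^esub>" "?g Dy [^]\<^bsub>?P\<^esub> (2::int) = \<one>\<^bsub>?P\<^esub>"
    "inv\<^bsub>?P\<^esub> ?g Dy \<otimes>\<^bsub>?P\<^esub> ?g Dx \<otimes>\<^bsub>?P\<^esub> ?g Dy = ?g Dx [^]\<^bsub>?P\<^esub> l"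
    using mem[THEN presented_group_relation] by simp_all
  interpret P: involution_action ?P "?g Dx" "?g Dy" l
    using rels P.int_pow_mult[of "?g Dy" 1 1] by unfold_locales simp_all
  have nf: "\<exists>i::int. A = ?g Dx [^]\<^bsub>?P\<^esub> i \<or> A = ?g Dy \<otimes>\<^bsub>?P\<^esub> ?g Dx [^]\<^bsub>?P\<^esub> i"
    if "A \<in> carrier ?P" for A
  proof -
    have "\<exists>i::int. P.word_eval ?g w = ?g Dx [^]\<^bsub>?P\<^esub> i \<or>
        P.word_eval ?g w = ?g Dy \<otimes>\<^bsub>?P\<^esub> ?g Dx [^]\<^bsub>?P\<^esub> i" for w
    proof (induction w)
      case Nil
      have "P.word_eval ?g [] = ?g Dx [^]\<^bsub>?P\<^esub> (0::int)"
        by simp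
      then show ?case by blast
    next
      case (Cons d w)
      obtain e where "d = (Dx, e) \<or> d = (Dy, e)"
        by (metis two_gen.exhaust surj_pair)
      then have "P.word_eval ?g (d # w) = ?g Dx [^]\<^bsub>?P\<^esub> (1::int) \<otimes>\<^bsub>?P\<^esub> P.word_eval ?g w \<or>
        P.word_eval ?g (d # w) = ?g Dx [^]\<^bsub>?P\<^esub> (- 1::int) \<otimes>\<^bsub>?P\<^esub> P.word_eval ?g w \<or>
        P.word_eval ?g (d # w) = ?g Dy \<otimes>\<^bsub>?P\<^esub> P.word_eval ?g w"
        by (cases e) (auto simp: P.word_eval_def P.inv_y P.int_pow_neg)
      then show ?case
        using P.normal_forms_left_mult[OF Cons.IH] by metis
    qed
    with that show ?thesis
      by (auto simp: carrier_presented_group word_eval_pres_gen)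
  qed
  have "h \<in> iso ?P G"
  proof (rule h.iso_iff[THEN iffD2], intro conjI subsetI ballI impI)
    fix q assume "q \<in> carrier G"
    then obtain i :: int where "q = x [^] i \<or> q = y \<otimes> x [^] i"
      using normal_form by blast
    then have "q = h (?g Dx [^]\<^bsub>?P\<^esub> i) \<or> q = h (?g Dy \<otimes>\<^bsub>?P\<^esub> ?g Dx [^]\<^bsub>?P\<^esub> i)"
      by (simp add: h.hom_int_pow hg)
    then show "q \<in> h ` carrier ?P"
      using g by (metis P.int_pow_closed P.m_closed imageI)
  next
    fix A assume A: "A \<in> carrier ?P" "h A = \<one>"
    from nf[OF A(1)] obtain i :: int
      where i: "A = ?g Dx [^]\<^bsub>?P\<^esub> i \<or> A = ?g Dy \<otimes>\<^bsub>?P\<^esub> ?g Dx [^]\<^bsub>?P\<^esub> i" ..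
    then have "x [^] i = \<one> \<or> y \<otimes> x [^] i = \<one>"
      using A(2) by (auto simp: h.hom_int_pow hg)
    moreover have "y \<otimes> x [^] i \<noteq> \<one>"
    proof
      assume "y \<otimes> x [^] i = \<one>"
      then have "y = x [^] (- i)"
        by (simp add: int_pow_neg inv_equality)
      then show False using y_notin by blast
    qed
    ultimately have dvd: "int M dvd i" and "A = ?g Dx [^]\<^bsub>?P\<^esub> i"
      using i A(2) by (auto simp: pow_eq_one h.hom_int_pow hg)
    then show "A = \<one>\<^bsub>?P\<^esub>"
      using rels(1) P.int_pow_pow[of "?g Dx" "int M"] by (auto elim!: dvdE)
  qed
  then have "?P \<cong> G" by (auto simp: is_iso_def)
  then show ?thesis by (rule P.iso_sym)
qed

end

section \<open>Square roots of one modulo powers of two\<close>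

text \<open>
  If \<open>k \<equiv> 1\<close> modulo 4, then \<open>k + 1\<close> is twice an odd number, so all but one of the factors 2
  of \<open>(k - 1)(k + 1)\<close> lie in \<open>k - 1\<close>.
\<close>

lemma sq_cong_one_mod_4:
  fixes k :: int
  assumes sq: "2 ^ Suc m dvd (k - 1) * (k + 1)" and k: "[k = 1] (mod 4)"
  shows "[k = 1] (mod 2 ^ m)"
proof -
  from k obtain u where u: "k = 4 * u + 1"
    by (metis cong_iff_lin cong_sym add.commute mult.commute)
  have "k + 1 = 2 * (2 * u + 1)"
    by (simp add: u)
  then have "(k - 1) * (k + 1) = 2 * ((k - 1) * (2 * u + 1))"
    by simp
  then have "2 ^ m dvd (k - 1) * (2 * u + 1)"
    using sq by (simp only: power_Suc dvd_mult_cancel_left) simp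
  moreover have "coprime (2 ^ m :: int) (2 * u + 1)"
    by simp
  ultimately show ?thesis
    by (simp add: coprime_dvd_mult_left_iff cong_iff_dvd_diff)
qed

text \<open>
  One of \<open>k\<close> and \<open>-k\<close> is congruent to 1 modulo 4, hence congruent to 1 modulo \<open>2\<^sup>m\<^sup>-\<^sup>1\<close>,
  and each residue modulo \<open>2\<^sup>m\<^sup>-\<^sup>1\<close> has exactly two lifts modulo \<open>2\<^sup>m\<close>.
\<close>

lemma sqrt_one_mod_power_of_two:
  fixes k :: int
  assumes "m \<ge> 1" and sq: "[k * k = 1] (mod 2 ^ m)"
  shows "[k = 1] (mod 2 ^ m) \<or> [k = 2 ^ m - 1] (mod 2 ^ m) \<or>
         [k = 2 ^ m div 2 - 1] (mod 2 ^ m) \<or> [k = 2 ^ m div 2 + 1] (mod 2 ^ m)"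
proof -
  obtain m' where m: "m = Suc m'"
    using assms(1) by (cases m) auto
  have double: "[l = 1] (mod 2 ^ m) \<or> [l = 1 + 2 ^ m'] (mod 2 ^ m)"
    if l: "[l = 1] (mod 2 ^ m')" for l :: int
  proof -
    obtain w where w: "l = 1 + 2 ^ m' * w"
      using l by (metis cong_iff_lin cong_sym)
    show ?thesis
    proof (cases "even w")
      case True
      then show ?thesis by (auto simp: w m cong_iff_dvd_diff elim!: evenE)
    next
      case False
      then obtain v where "w = 2 * v + 1" by (rule oddE)
      then have "l - (1 + 2 ^ m') = 2 ^ m * v"
        by (simp add: w m algebra_simps)
      then show ?thesis by (simp add: cong_iff_dvd_diff)
    qed
  qed
  have "k * k - 1 = (k - 1) * (k + 1)"
    by (simp add: algebra_simps)
  then have dvd: "2 ^ m dvd (k - 1) * (k + 1)"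
    using sq by (simp add: cong_iff_dvd_diff)
  have "odd k"
  proof -
    have "2 dvd (k - 1) * (k + 1)"
      using dvd by (rule dvd_trans[rotated]) (simp add: m)
    then show ?thesis by simp
  qed
  then obtain v where v: "k = 2 * v + 1" by (rule oddE)
  have "4 dvd k - 1 \<or> 4 dvd - k - 1"
  proof (cases "even v")
    case True
    then show ?thesis by (auto simp: v elim!: evenE)
  next
    case False
    then obtain w where "v = 2 * w + 1" by (rule oddE)
    then have "- k - 1 = 4 * (- w - 1)" by (simp add: v)
    then show ?thesis by (metis dvd_triv_left)
  qed
  then consider "[k = 1] (mod 4)" | "[- k = 1] (mod 4)"
    by (auto simp: cong_iff_dvd_diff)
  then show ?thesis
  proof cases
    case 1
    then show ?thesis
      using double sq_cong_one_mod_4[of m' k] dvd by (auto simp: m add.commute)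
  next
    case 2
    moreover have "(- k - 1) * (- k + 1) = (k - 1) * (k + 1)"
      by (simp add: algebra_simps)
    ultimately have "[- k = 1] (mod 2 ^ m')"
      using sq_cong_one_mod_4[of m' "- k"] dvd by (simp only: m)
    then have "[- k = 1] (mod 2 ^ m) \<or> [- k = 1 + 2 ^ m'] (mod 2 ^ m)"
      by (rule double)
    moreover have "[k = 2 ^ m - 1] (mod 2 ^ m)" if "[- k = 1] (mod 2 ^ m)"
    proof -
      have "2 ^ m dvd 2 ^ m + (- k - 1)"
        using that by (simp add: cong_iff_dvd_diff)
      moreover have "2 ^ m + (- k - 1) = - (k - (2 ^ m - 1))"
        by simp
      ultimately show ?thesis
        by (simp only: cong_iff_dvd_diff dvd_minus_iff)
    qed
    moreover have "[k = 2 ^ m' - 1] (mod 2 ^ m)" if "[- k = 1 + 2 ^ m'] (mod 2 ^ m)"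
    proof -
      have "2 ^ m dvd 2 ^ m + (- k - (1 + 2 ^ m'))"
        using that by (simp add: cong_iff_dvd_diff)
      moreover have "2 ^ m + (- k - (1 + 2 ^ m')) = - (k - (2 ^ m' - 1))"
        by (simp add: m algebra_simps)
      ultimately show ?thesis
        by (simp only: cong_iff_dvd_diff dvd_minus_iff)
    qed
    ultimately show ?thesis by (auto simp: m)
  qed
qed


section \<open>Commuting generators and subgroups above a normal subgroup\<close>

text \<open>
  Centralizers are subgroups: the centralizer of \<open>{a, b}\<close> contains \<open>\<langle>a, b\<rangle>\<close>, so the centralizer
  of \<open>\<langle>a, b\<rangle>\<close> contains \<open>a\<close> and \<open>b\<close>, hence again all of \<open>\<langle>a, b\<rangle>\<close>.
\<close>

lemma (in group) generate_commuting_pair: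
  assumes ab: "a \<in> carrier G" "b \<in> carrier G" "a \<otimes> b = b \<otimes> a"
    and uv: "u \<in> generate G {a, b}" "v \<in> generate G {a, b}"
  shows "u \<otimes> v = v \<otimes> u"
proof -
  \<comment> \<open>\<open>C S\<close> is the centralizer of \<open>S\<close>.\<close>
  define C where "C S = {g \<in> carrier G. \<forall>s\<in>S. s \<otimes> g = g \<otimes> s}" for S
  have C: "subgroup (C S) G" if S: "S \<subseteq> carrier G" for S
  proof (rule subgroupI)
    show "C S \<noteq> {}"
      using S by (auto simp: C_def intro!: exI[of _ \<one>])
  next
    fix g assume g: "g \<in> C S"
    have "s \<otimes> inv g = inv g \<otimes> s" if "s \<in> S" for s
    proof -
      have sg: "s \<in> carrier G" "g \<in> carrier G" "s \<otimes> g = g \<otimes> s"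
        using g S that by (auto simp: C_def)
      then have "inv g \<otimes> (s \<otimes> g) \<otimes> inv g = inv g \<otimes> (g \<otimes> s) \<otimes> inv g"
        by simp
      then show ?thesis
        using sg(1,2) by (metis inv_closed inv_solve_left inv_solve_right m_assoc m_closed)
    qed
    then show "inv g \<in> C S"
      using g by (simp add: C_def)
  next
    fix g h assume gh: "g \<in> C S" "h \<in> C S"
    have "s \<otimes> (g \<otimes> h) = g \<otimes> h \<otimes> s" if "s \<in> S" for s
    proof -
      have "s \<in> carrier G" "g \<in> carrier G" "h \<in> carrier G" "s \<otimes> g = g \<otimes> s" "s \<otimes> h = h \<otimes> s"
        using gh S that by (auto simp: C_def)
      then show ?thesis by (metis m_assoc)
    qed
    with gh show "g \<otimes> h \<in> C S"
      by (auto simp: C_def)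
  qed (auto simp: C_def)
  let ?B = "generate G {a, b}"
  have B: "?B \<subseteq> carrier G"
    using ab generate_incl[of "{a, b}"] by simp
  have "?B \<subseteq> C {a, b}"
    using ab by (intro generate_subgroup_incl C) (auto simp: C_def)
  then have "{a, b} \<subseteq> C ?B"
    using ab by (auto simp: C_def)
  then have "?B \<subseteq> C ?B"
    by (rule generate_subgroup_incl[OF _ C[OF B]])
  then show ?thesis
    using uv by (auto simp: C_def)
qed

lemma (in normal) rcos_eq_one_iff:
  assumes "g \<in> carrier G"
  shows "H #> g = \<one>\<^bsub>G Mod H\<^esub> \<longleftrightarrow> g \<in> H"
  using assms coset_join1[OF _ assms subgroup_axioms] coset_join2[OF assms subgroup_axioms] by auto

lemma (in normal) normal_above_if_factgroup_comm:
  assumes "comm_group (G Mod H)" and L: "subgroup L G" "H \<subseteq> L"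
  shows "L \<lhd> G"
  unfolding normal_inv_iff
proof (intro conjI ballI L(1))
  interpret Q: comm_group "G Mod H" by fact
  fix g l assume g: "g \<in> carrier G" and l: "l \<in> L"
  then have lG: "l \<in> carrier G" using L(1) subgroup.subset by blast
  have "H #> (g \<otimes> l) = H #> (l \<otimes> g)"
    using hom_mult[OF r_coset_hom_Mod g lG] hom_mult[OF r_coset_hom_Mod lG g]
      Q.m_comm[OF hom_in_carrier[OF r_coset_hom_Mod g] hom_in_carrier[OF r_coset_hom_Mod lG]]
    by metis
  then have "g \<otimes> l \<in> H #> (l \<otimes> g)"
    using rcos_self[OF _ subgroup_axioms] g lG by (metis m_closed)
  then obtain k where k: "k \<in> H" "g \<otimes> l = k \<otimes> (l \<otimes> g)"
    by (auto simp: r_coset_def)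
  then have "g \<otimes> l \<otimes> inv g = k \<otimes> l"
    using g lG by (simp add: m_assoc)
  then show "g \<otimes> l \<otimes> inv g \<in> L"
    using k(1) l L by (auto simp: subgroup.m_closed)
qed


section \<open>Extensions of the wreathed group by a cyclic group\<close>

theorem proposition3p2:
  fixes n m :: nat and p q r s c :: int
  defines "M \<equiv> (2::nat) ^ m"
  defines "R \<equiv> ext_rels n m p q r s c"
  defines "G \<equiv> presented_group R"
  defines "a \<equiv> pres_gen R Ga"
  defines "b \<equiv> pres_gen R Gb"
  defines "t \<equiv> pres_gen R Gt"
  defines "z \<equiv> pres_gen R Gz"
  defines "H \<equiv> generate G {a, b, t}"
  defines "K \<equiv> generate G {z}"
  defines "B \<equiv> generate G {a, b}"
  defines "k \<equiv> (1 - 2 * c) mod int M"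
  defines "Q \<equiv> G Mod B"
  defines "Z \<equiv> generate Q {B #>\<^bsub>G\<^esub> z}"
  assumes "n \<ge> 1" and "m \<ge> 1"
  assumes "exact_product G H K"
  assumes "G\<lparr>carrier := H\<rparr> \<cong> wreathed_group n"
  assumes "G\<lparr>carrier := K\<rparr> \<cong> integer_mod_group M"
  assumes "B \<lhd> G"
  shows "(\<exists>\<beta>\<in>B. inv\<^bsub>G\<^esub> t \<otimes>\<^bsub>G\<^esub> z \<otimes>\<^bsub>G\<^esub> t = z [^]\<^bsub>G\<^esub> (1 - 2 * c) \<otimes>\<^bsub>G\<^esub> \<beta>) \<and>
    (comm_group Q \<longleftrightarrow> [k = 1] (mod int M)) \<and>
    (H \<lhd> G \<longleftrightarrow> [k = 1] (mod int M)) \<and>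
    ([k = 1] (mod int M) \<longleftrightarrow> [2 * c = 0] (mod int M)) \<and>
    (\<not> [k = 1] (mod int M) \<longrightarrow>
       group Q \<and> \<not> comm_group Q \<and> order Q = 2 * M \<and>
       subgroup Z Q \<and> cyclic_group (Q\<lparr>carrier := Z\<rparr>) \<and> card (rcosets\<^bsub>Q\<^esub> Z) = 2 \<and>
       ([k = int M - 1] (mod int M) \<or>
        [k = int M div 2 - 1] (mod int M) \<or>
        [k = int M div 2 + 1] (mod int M)) \<and>
       ([k = int M - 1] (mod int M) \<longrightarrow> Q \<cong> dihedral_group M) \<and>
       ([k = int M div 2 - 1] (mod int M) \<longrightarrow> Q \<cong> semidihedral_group M) \<and>
       ([k = int M div 2 + 1] (mod int M) \<longrightarrow> Q \<cong> modular_max_cyclic_group M)) \<and>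
    (\<not> [2 * c = 0] (mod int M) \<longrightarrow> \<not> H \<lhd> G)"
proof -
  interpret G: group G unfolding G_def by (rule group_presented_group)
  interpret B: normal B G by fact
  interpret Q: group Q unfolding Q_def by (rule B.factorgroup_is_group)
  define \<pi> where "\<pi> = (\<lambda>g. B #>\<^bsub>G\<^esub> g)"
  interpret \<pi>: group_hom G Q \<pi>
    using B.r_coset_hom_Mod
    by (intro group_hom.intro group_hom_axioms.intro G.group_axioms Q.group_axioms)
      (simp add: \<pi>_def Q_def)
  have [simp]: "a \<in> carrier G" "b \<in> carrier G" "t \<in> carrier G" "z \<in> carrier G"
    by (simp_all add: a_def b_def t_def z_def G_def)
  have \<pi>_one: "\<pi> g = \<one>\<^bsub>Q\<^esub> \<longleftrightarrow> g \<in> B" if "g \<in> carrier G" for g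
    using B.rcos_eq_one_iff[OF that] by (simp add: \<pi>_def Q_def)

  have gens: "a \<in> B" "b \<in> B" "a \<in> H" "b \<in> H" "t \<in> H" "z \<in> K"
    by (simp_all add: B_def H_def K_def generate.incl)
  have subH: "subgroup H G" and subK: "subgroup K G" and HK: "carrier G = H <#>\<^bsub>G\<^esub> K"
    and HK1: "H \<inter> K = {\<one>\<^bsub>G\<^esub>}"
    using \<open>exact_product G H K\<close> by (auto simp: exact_product_def)
  have "B \<subseteq> H"
    unfolding B_def using gens by (intro G.generate_subgroup_incl subH) auto

  have mem: "(wpow (wgen Gt) 2, []) \<in> R" "(wcomm (wgen Ga) (wgen Gb), []) \<in> R"
    "(wconj (wgen Gt) (wgen Gz),
      wgen Gt @ wpow (wgen Gz) (2 * c) @ wpow (wgen Ga) r @ wpow (wgen Gb) s) \<in> R"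
    by (simp_all add: R_def ext_rels_def Let_def)
  note eval = mem[THEN presented_group_relation, folded G_def]
  have gen_closed: "pres_gen R x \<in> carrier G" for x
    by (simp add: G_def)
  have t2: "t [^]\<^bsub>G\<^esub> (2::int) = \<one>\<^bsub>G\<^esub>"
    using eval(1) by (simp add: gen_closed t_def)
  have "inv\<^bsub>G\<^esub> a \<otimes>\<^bsub>G\<^esub> inv\<^bsub>G\<^esub> b \<otimes>\<^bsub>G\<^esub> a \<otimes>\<^bsub>G\<^esub> b = \<one>\<^bsub>G\<^esub>"
    using eval(2) by (simp add: gen_closed a_def b_def)
  then have ab: "a \<otimes>\<^bsub>G\<^esub> b = b \<otimes>\<^bsub>G\<^esub> a"
    by (simp add: G.m_assoc G.inv_solve_left')
  have "inv\<^bsub>G\<^esub> z \<otimes>\<^bsub>G\<^esub> t \<otimes>\<^bsub>G\<^esub> z =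
      t \<otimes>\<^bsub>G\<^esub> (z [^]\<^bsub>G\<^esub> (2 * c) \<otimes>\<^bsub>G\<^esub> (a [^]\<^bsub>G\<^esub> r \<otimes>\<^bsub>G\<^esub> b [^]\<^bsub>G\<^esub> s))"
    using eval(3) by (simp add: gen_closed a_def b_def t_def z_def)
  moreover have "a [^]\<^bsub>G\<^esub> r \<otimes>\<^bsub>G\<^esub> b [^]\<^bsub>G\<^esub> s \<in> B"
    using gens by (intro B.m_closed G.subgroup_int_pow_closed B.subgroup_axioms)
  ultimately obtain w where w: "w \<in> B"
    and tz: "inv\<^bsub>G\<^esub> z \<otimes>\<^bsub>G\<^esub> t \<otimes>\<^bsub>G\<^esub> z = t \<otimes>\<^bsub>G\<^esub> (z [^]\<^bsub>G\<^esub> (2 * c) \<otimes>\<^bsub>G\<^esub> w)"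
    by blast
  have [simp]: "w \<in> carrier G" and "\<pi> w = \<one>\<^bsub>Q\<^esub>"
    using w by (simp_all add: \<pi>_one)

  have "M > 0" by (simp add: M_def)
  have "card K = M"
    using iso_same_card[OF \<open>G\<lparr>carrier := K\<rparr> \<cong> integer_mod_group M\<close>] \<open>M > 0\<close>
    by (simp add: carrier_integer_mod_group)
  then have z_pow: "z [^]\<^bsub>G\<^esub> i = \<one>\<^bsub>G\<^esub> \<longleftrightarrow> int M dvd i" for i :: int
    using G.generate_pow_card[of z] G.int_pow_eq_id[of z i] by (simp add: K_def)
  have z_H: "z [^]\<^bsub>G\<^esub> i \<in> H \<longleftrightarrow> int M dvd i" for i :: int
    using HK1 z_pow[of i] G.subgroup_int_pow_closed[OF subK gens(6), of i]
      subgroup.one_closed[OF subH] by auto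

  \<comment> \<open>Otherwise \<open>H = B\<close> would be abelian, since \<open>a\<close> and \<open>b\<close> commute.\<close>
  have "t \<notin> B"
  proof
    assume "t \<in> B"
    then have "H \<subseteq> B"
      unfolding H_def using gens by (intro G.generate_subgroup_incl B.subgroup_axioms) auto
    then have "u \<otimes>\<^bsub>G\<^esub> v = v \<otimes>\<^bsub>G\<^esub> u" if "u \<in> H" "v \<in> H" for u v
      using that G.generate_commuting_pair[OF _ _ ab, of u v] by (auto simp: B_def)
    then have "comm_group (G\<lparr>carrier := H\<rparr>)"
      using G.subgroup_imp_group[OF subH] by (intro group.group_comm_groupI) simp_all
    moreover have "monoid (wreathed_group n)"
      unfolding wreathed_group_def by (intro group.is_monoid group_presented_group)
    ultimately have "comm_group (wreathed_group n)"
      using comm_group.iso_imp_comm_group \<open>G\<lparr>carrier := H\<rparr> \<cong> wreathed_group n\<close> by blast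
    then show False
      using wreathed_group_not_comm[OF \<open>n \<ge> 1\<close>] by blast
  qed

  have "t \<otimes>\<^bsub>G\<^esub> t = \<one>\<^bsub>G\<^esub>"
    using t2 G.int_pow_mult[of t 1 1] by simp
  then have tt: "\<pi> t \<otimes>\<^bsub>Q\<^esub> \<pi> t = \<one>\<^bsub>Q\<^esub>"
    using \<pi>.hom_mult[of t t] by (simp del: \<pi>.hom_mult)
  have inv_t: "inv\<^bsub>Q\<^esub> \<pi> t = \<pi> t"
    by (rule Q.inv_equality) (simp_all add: tt)
  have H_cosets: "\<pi> h = \<one>\<^bsub>Q\<^esub> \<or> \<pi> h = \<pi> t" if "h \<in> H" for h
  proof -
    have \<pi>_ab: "\<pi> a = \<one>\<^bsub>Q\<^esub>" "\<pi> b = \<one>\<^bsub>Q\<^esub>"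
      using gens by (simp_all add: \<pi>_one)
    from that[unfolded H_def] show ?thesis
    proof (induction rule: generate.induct)
      case (eng g h)
      then have "g \<in> carrier G" "h \<in> carrier G"
        using subgroup.subset[OF subH] by (auto simp: H_def)
      with eng.IH tt show ?case by auto
    qed (auto simp: \<pi>_ab inv_t)
  qed

  \<comment> \<open>Exactness of \<open>G = HK\<close> enters twice: no nontrivial power of \<open>z\<close> lies in \<open>B \<subseteq> H\<close>, so
    \<open>zB\<close> keeps the order \<open>M\<close>; and \<open>tB\<close> is not a power of \<open>zB\<close>, since such a power would lie in
    \<open>H \<inter> K\<close> and force \<open>t \<in> B\<close>.\<close>
  interpret Q: cyclic_by_involution Q "\<pi> z" "\<pi> t" "1 - 2 * c" M
  proof
    show "\<pi> z \<in> carrier Q" "\<pi> t \<in> carrier Q" by simp_all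
    show "\<pi> t \<otimes>\<^bsub>Q\<^esub> \<pi> t = \<one>\<^bsub>Q\<^esub>" by (rule tt)
    have "\<pi> (inv\<^bsub>G\<^esub> z \<otimes>\<^bsub>G\<^esub> t \<otimes>\<^bsub>G\<^esub> z) = \<pi> t \<otimes>\<^bsub>Q\<^esub> \<pi> z [^]\<^bsub>Q\<^esub> (2 * c)"
      by (simp add: tz \<pi>.hom_int_pow \<open>\<pi> w = \<one>\<^bsub>Q\<^esub>\<close>)
    then have "inv\<^bsub>Q\<^esub> \<pi> z \<otimes>\<^bsub>Q\<^esub> \<pi> t \<otimes>\<^bsub>Q\<^esub> \<pi> z = \<pi> t \<otimes>\<^bsub>Q\<^esub> \<pi> z [^]\<^bsub>Q\<^esub> (2 * c)"
      by simp
    then show "inv\<^bsub>Q\<^esub> \<pi> t \<otimes>\<^bsub>Q\<^esub> \<pi> z \<otimes>\<^bsub>Q\<^esub> \<pi> t = \<pi> z [^]\<^bsub>Q\<^esub> (1 - 2 * c)"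
      by (intro Q.conj_eq_mult_pow_swap) simp_all
    show "M > 0" by fact
    have \<pi>_z: "\<pi> z [^]\<^bsub>Q\<^esub> i = \<pi> (z [^]\<^bsub>G\<^esub> i)" for i :: int
      by (simp add: \<pi>.hom_int_pow)
    show "\<pi> z [^]\<^bsub>Q\<^esub> i = \<one>\<^bsub>Q\<^esub> \<longleftrightarrow> int M dvd i" for i :: int
      using z_H[of i] z_pow[of i] \<open>B \<subseteq> H\<close> by (auto simp: \<pi>_z \<pi>_one)
    show "\<pi> t \<noteq> \<pi> z [^]\<^bsub>Q\<^esub> i" for i :: int
    proof
      assume "\<pi> t = \<pi> z [^]\<^bsub>Q\<^esub> i"
      then have "\<pi> (t \<otimes>\<^bsub>G\<^esub> z [^]\<^bsub>G\<^esub> i) = \<one>\<^bsub>Q\<^esub>"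
        using tt by (simp add: \<pi>_z)
      then have "t \<otimes>\<^bsub>G\<^esub> z [^]\<^bsub>G\<^esub> i \<in> B"
        by (simp add: \<pi>_one del: \<pi>.hom_mult)
      then have "inv\<^bsub>G\<^esub> t \<otimes>\<^bsub>G\<^esub> (t \<otimes>\<^bsub>G\<^esub> z [^]\<^bsub>G\<^esub> i) \<in> H"
        using \<open>B \<subseteq> H\<close> gens(5) subH by (meson subgroup.m_closed subgroup.m_inv_closed subsetD)
      then have "z [^]\<^bsub>G\<^esub> i \<in> H"
        by (simp add: G.m_assoc[symmetric])
      then have "z [^]\<^bsub>G\<^esub> i = \<one>\<^bsub>G\<^esub>"
        by (simp add: z_H z_pow)
      then have "t \<in> B"
        using \<open>t \<otimes>\<^bsub>G\<^esub> z [^]\<^bsub>G\<^esub> i \<in> B\<close> by simp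
      with \<open>t \<notin> B\<close> show False ..
    qed
    fix u assume "u \<in> carrier Q"
    then obtain g where g: "g \<in> carrier G" "u = \<pi> g"
      by (auto simp: Q_def carrier_FactGroup \<pi>_def)
    then obtain h x where hx: "h \<in> H" "x \<in> K" "g = h \<otimes>\<^bsub>G\<^esub> x"
      unfolding HK by (auto simp: set_mult_def)
    obtain i :: int where i: "x = z [^]\<^bsub>G\<^esub> i"
      using hx(2) by (auto simp: K_def G.generate_pow)
    have "h \<in> carrier G" using hx(1) subH subgroup.subset by blast
    then have "u = \<pi> h \<otimes>\<^bsub>Q\<^esub> \<pi> z [^]\<^bsub>Q\<^esub> i"
      using g(2) hx(3) i by (simp add: \<pi>_z)
    then show "\<exists>i::int. u = \<pi> z [^]\<^bsub>Q\<^esub> i \<or> u = \<pi> t \<otimes>\<^bsub>Q\<^esub> \<pi> z [^]\<^bsub>Q\<^esub> i"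
      using H_cosets[OF hx(1)] by auto
  qed

  have k: "[k = 1 - 2 * c] (mod int M)"
    by (simp add: k_def cong_def)
  have k_cong: "[1 - 2 * c = l] (mod int M) \<longleftrightarrow> [k = l] (mod int M)" for l
    using k by (meson cong_sym cong_trans)
  have k1: "[k = 1] (mod int M) \<longleftrightarrow> [2 * c = 0] (mod int M)"
    using k_cong[of 1] by (simp add: cong_iff_dvd_diff)
  have comm: "comm_group Q \<longleftrightarrow> [k = 1] (mod int M)"
    by (simp add: Q.comm_group_iff k_cong)
  have normal: "H \<lhd> G \<longleftrightarrow> [k = 1] (mod int M)"
  proof
    assume "H \<lhd> G"
    then interpret H: normal H G .
    \<comment> \<open>The relation for \<open>t\<^sup>z\<close>, solved for \<open>z\<^sup>2\<^sup>c\<close>, exhibits it as an element of \<open>H \<inter> K\<close>.\<close>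
    have "inv\<^bsub>G\<^esub> t \<otimes>\<^bsub>G\<^esub> (inv\<^bsub>G\<^esub> z \<otimes>\<^bsub>G\<^esub> t \<otimes>\<^bsub>G\<^esub> z) \<otimes>\<^bsub>G\<^esub> inv\<^bsub>G\<^esub> w \<in> H"
      using w gens(5) \<open>B \<subseteq> H\<close>
      by (intro H.m_closed H.m_inv_closed H.inv_op_closed1) auto
    also have "inv\<^bsub>G\<^esub> t \<otimes>\<^bsub>G\<^esub> (inv\<^bsub>G\<^esub> z \<otimes>\<^bsub>G\<^esub> t \<otimes>\<^bsub>G\<^esub> z) \<otimes>\<^bsub>G\<^esub> inv\<^bsub>G\<^esub> w = z [^]\<^bsub>G\<^esub> (2 * c)"
      by (simp add: tz G.inv_solve_right' G.inv_solve_left')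
    finally show "[k = 1] (mod int M)"
      by (simp add: z_H k1 cong_0_iff)
  next
    assume "[k = 1] (mod int M)"
    then show "H \<lhd> G"
      using B.normal_above_if_factgroup_comm[OF _ subH \<open>B \<subseteq> H\<close>] comm by (simp add: Q_def)
  qed

  have "\<exists>\<beta>\<in>B. inv\<^bsub>G\<^esub> t \<otimes>\<^bsub>G\<^esub> z \<otimes>\<^bsub>G\<^esub> t = z [^]\<^bsub>G\<^esub> (1 - 2 * c) \<otimes>\<^bsub>G\<^esub> \<beta>"
  proof
    let ?\<beta> = "inv\<^bsub>G\<^esub> (z [^]\<^bsub>G\<^esub> (1 - 2 * c)) \<otimes>\<^bsub>G\<^esub> (inv\<^bsub>G\<^esub> t \<otimes>\<^bsub>G\<^esub> z \<otimes>\<^bsub>G\<^esub> t)"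
    have "\<pi> ?\<beta> = \<one>\<^bsub>Q\<^esub>"
      by (simp add: Q.x_conj \<pi>.hom_int_pow)
    then show "?\<beta> \<in> B"
      by (simp add: \<pi>_one del: \<pi>.hom_mult)
    show "inv\<^bsub>G\<^esub> t \<otimes>\<^bsub>G\<^esub> z \<otimes>\<^bsub>G\<^esub> t = z [^]\<^bsub>G\<^esub> (1 - 2 * c) \<otimes>\<^bsub>G\<^esub> ?\<beta>"
      by (simp add: G.inv_solve_left' G.m_assoc[symmetric])
  qed
  moreover have "[k = 1] (mod int M) \<or> [k = int M - 1] (mod int M) \<or>
      [k = int M div 2 - 1] (mod int M) \<or> [k = int M div 2 + 1] (mod int M)"
  proof -
    have "[k * k = 1] (mod 2 ^ m)"
      using cong_trans[OF cong_mult[OF k k] Q.exponent_sq] by (simp add: M_def)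
    from sqrt_one_mod_power_of_two[OF \<open>m \<ge> 1\<close> this] show ?thesis
      by (simp add: M_def)
  qed
  moreover have Z: "Z = generate Q {\<pi> z}"
    by (simp add: Z_def \<pi>_def)
  ultimately show ?thesis
    using Q.group_axioms Q.order_eq Q.subgroup_powers Q.cyclic_powers Q.card_rcosets_powers
      Q.iso_presented_group comm normal k1
    unfolding Z k_cong dihedral_group_def semidihedral_group_def modular_max_cyclic_group_def
    by blast
qed

end
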